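(* For every non-negative integer $m$, \[ T_m(q)=\sum_{1\le c_1<\dots<c_m\le 2m}\ \prod_{j=1}^m[r_j-(j-1)]_q, \] where $r_j=\#\{i\in\{1,\dots,m\}: c_i\le j+i-1\}$.
   Context: For a fixed-point-free involution $\sigma$ of $\{1,\dots,2m\}$, its arcs are the pairs $(i,\sigma(i))$ with $i<\sigma(i)$; a crossing is a pair of arcs $(i,j),(k,l)$ with $i<k<j<l$, and $v(\sigma)$ is the number of crossings. $T_m(q)=\sum_\sigma q^{v(\sigma)}$, summed over all fixed-point-free involutions $\sigma$ of $\{1,\dots,2m\}$. For a non-negative integer $n$, $[n]_q=1+q+\dots+q^{n-1}$. *)

theory Defs
  imports Main "HOL-Library.FuncSet" "HOL-Combinatorics.Permutations"
begin

definition fpf_involutions :: "nat \<Rightarrow> (nat \<Rightarrow> nat) set" where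
  "fpf_involutions m =
     {\<sigma>. \<sigma> permutes {1..2*m} \<and> (\<forall>i\<in>{1..2*m}. \<sigma> (\<sigma> i) = i \<and> \<sigma> i \<noteq> i)}"

definition arcs :: "nat \<Rightarrow> (nat \<Rightarrow> nat) \<Rightarrow> (nat \<times> nat) set" where
  "arcs m \<sigma> = {(i, \<sigma> i) | i. i \<in> {1..2*m} \<and> i < \<sigma> i}"

text \<open>The condition \<open>i < k\<close> orders the two arcs, so each crossing is counted once.\<close>

definition crossings :: "nat \<Rightarrow> (nat \<Rightarrow> nat) \<Rightarrow> ((nat \<times> nat) \<times> (nat \<times> nat)) set" where
  "crossings m \<sigma> =
     {((i, j), (k, l)) | i j k l.
        (i, j) \<in> arcs m \<sigma> \<and> (k, l) \<in> arcs m \<sigma> \<and> i < k \<and> k < j \<and> j < l}"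

definition v :: "nat \<Rightarrow> (nat \<Rightarrow> nat) \<Rightarrow> nat" where
  "v m \<sigma> = card (crossings m \<sigma>)"

text \<open>Here \<open>q\<close> is an arbitrary element of an arbitrary commutative ring; the polynomial
  in an indeterminate is the instance \<open>q = [:0, 1:]\<close> in the type \<open>int poly\<close>.\<close>

definition T :: "nat \<Rightarrow> 'a::comm_ring_1 \<Rightarrow> 'a" where
  "T m q = (\<Sum>\<sigma>\<in>fpf_involutions m. q ^ v m \<sigma>)"

definition q_number :: "nat \<Rightarrow> 'a::comm_ring_1 \<Rightarrow> 'a" where
  "q_number n q = (\<Sum>i<n. q ^ i)"

text \<open>Sequences \<open>1 \<le> c 1 < \<dots> < c m \<le> 2 * m\<close>; the extensional function space makes
  each of them a single function (undefined outside \<open>{1..m}\<close>).\<close>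

definition increasing_seqs :: "nat \<Rightarrow> (nat \<Rightarrow> nat) set" where
  "increasing_seqs m = {c \<in> {1..m} \<rightarrow>\<^sub>E {1..2*m}. strict_mono_on {1..m} c}"

definition r :: "nat \<Rightarrow> (nat \<Rightarrow> nat) \<Rightarrow> nat \<Rightarrow> nat" where
  "r m c j = card {i \<in> {1..m}. c i \<le> j + i - 1}"

text \<open>The difference \<open>r m c j - (j - 1)\<close> can be negative, where the q-number is not defined.
  The following lemma shows that then an earlier index \<open>k\<close> has \<open>r m c k - (k - 1) = 0\<close>,
  so that the product over \<open>j\<close> contains the factor \<open>q_number 0 q = 0\<close> and vanishes
  whatever value is given to the q-number of a negative integer. Truncated subtraction on
  the natural numbers is therefore harmless.\<close>

lemma r_negative_difference:
  assumes "j \<in> {1..m}" and "r m c j < j - 1"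
  shows "\<exists>k\<in>{1..<j}. r m c k = k - 1"
proof -
  have mono: "r m c a \<le> r m c b" if "a \<le> b" for a b
    unfolding r_def using that by (intro card_mono) auto
  define k where "k = (LEAST k. 1 \<le> k \<and> r m c k < k)"
  have ex: "1 \<le> j \<and> r m c j < j" using assms by auto
  have k: "1 \<le> k" "r m c k < k"
    using LeastI[of "\<lambda>k. 1 \<le> k \<and> r m c k < k", OF ex] by (auto simp: k_def)
  have "k \<le> j" unfolding k_def by (rule Least_le) (rule ex)
  have "k - 1 \<le> r m c k"
  proof (cases "k = 1")
    case False
    have "k - 1 < k" using k by simp
    then have "\<not> (1 \<le> k - 1 \<and> r m c (k - 1) < k - 1)"
      unfolding k_def by (rule not_less_Least)
    with False k mono[of "k - 1" k] show ?thesis by linarith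
  qed simp
  with k have "r m c k = k - 1" by linarith
  moreover from this assms \<open>k \<le> j\<close> have "k < j" by (cases "k = j") auto
  ultimately show ?thesis using k by auto
qed

end

theory Submission imports Defs begin

text \<open>Read the points from left to right and keep track of the open arcs. If the next point
  closes one of \<open>h\<close> open arcs, say that with left end \<open>i\<close>, the crossings created are with the
  open arcs starting to the right of \<open>i\<close>, so the choice of \<open>i\<close> contributes the factor \<open>[h]\<^sub>q\<close>.
  Hence \<open>T m q\<close> is the sum, over the sets \<open>C\<close> of left ends, of the product of these factors.
  If \<open>C\<close> is enumerated by \<open>c\<close>, then \<open>r m c j\<close> counts the left ends before the \<open>j\<close>-th right end,
  which makes \<open>r m c j - (j - 1)\<close> the number of open arcs there. A set \<open>C\<close> that does not come
  from an involution contributes \<open>0\<close>: at its first unmatched right end no arc is open.\<close>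

text \<open>A crossing is encoded by the left ends of its two arcs: the inequalities already force
  \<open>x < \<sigma> x\<close> and \<open>y < \<sigma> y\<close>.\<close>

definition crossing_number :: "('b::linorder \<Rightarrow> 'b) \<Rightarrow> nat" where
  "crossing_number \<sigma> = card {(x, y). x < y \<and> y < \<sigma> x \<and> \<sigma> x < \<sigma> y}"

text \<open>\<open>A\<close> is the set of left ends already read, still to be matched with points of \<open>B\<close>.\<close>

definition matchings :: "'b set \<Rightarrow> 'b set \<Rightarrow> ('b \<Rightarrow> 'b) set" where
  "matchings A B =
     {\<sigma>. (\<forall>x. \<sigma> (\<sigma> x) = x) \<and> (\<forall>x. \<sigma> x \<noteq> x \<longleftrightarrow> x \<in> A \<union> B) \<and> (\<forall>x\<in>A. \<sigma> x \<notin> A)}"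

text \<open>The number of open arcs just before \<open>d\<close>, if \<open>a\<close> arcs are open before \<open>B\<close> and \<open>C\<close> is the
  set of left ends in \<open>B\<close>; the truncation is harmless as in \<open>r_negative_difference\<close>.\<close>

definition height :: "nat \<Rightarrow> 'b::linorder set \<Rightarrow> 'b set \<Rightarrow> 'b \<Rightarrow> nat" where
  "height a B C d = a + card {x \<in> C. x < d} - card {x \<in> B - C. x < d}"

definition closer_weight :: "nat \<Rightarrow> 'b::linorder set \<Rightarrow> 'b set \<Rightarrow> 'a \<Rightarrow> 'a::comm_ring_1" where
  "closer_weight a B C q = (\<Prod>d\<in>B - C. q_number (height a B C d) q)"

section \<open>Matchings and the role of the next point\<close>

lemma matchings_subset:
  "matchings A B \<subseteq> {\<sigma>. \<sigma> permutes A \<union> B}"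
proof
  fix \<sigma> assume \<sigma>: "\<sigma> \<in> matchings A B"
  then have "bij \<sigma>" by (intro o_bij[of \<sigma>]) (auto simp: matchings_def)
  with \<sigma> show "\<sigma> \<in> {\<sigma>. \<sigma> permutes A \<union> B}"
    by (auto simp: matchings_def permutes_def bij_iff)
qed

lemma finite_matchings:
  assumes "finite A" "finite B"
  shows "finite (matchings A B)"
  by (rule finite_subset[OF matchings_subset finite_permutations]) (simp add: assms)

text \<open>The base case: with no points left to read, an open left end has no possible partner,
  since its partner is moved as well and would again lie in \<open>A\<close>.\<close>

lemma matchings_empty_right: "matchings A {} = (if A = {} then {id} else {})"
proof -
  have "x = id" if "x \<in> matchings {} {}" for x :: "'a \<Rightarrow> 'a"
    using that by (auto simp: matchings_def)
  moreover have "matchings A {} = {}" if "A \<noteq> {}"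
    using that unfolding matchings_def by fastforce
  ultimately show ?thesis by (auto simp: matchings_def)
qed

text \<open>If the partner of the next point \<open>b\<close> is not an open left end, it lies in
  \<open>B\<close>, so \<open>b\<close> itself becomes an open left end.\<close>

lemma matchings_opener:
  assumes "b \<notin> A" "b \<notin> B"
  shows "{\<sigma> \<in> matchings A (insert b B). \<sigma> b \<notin> A} = matchings (insert b A) B"
proof (intro set_eqI iffI)
  fix \<sigma> assume "\<sigma> \<in> {\<sigma> \<in> matchings A (insert b B). \<sigma> b \<notin> A}"
  then have *: "\<And>x. \<sigma> (\<sigma> x) = x" "\<And>x. \<sigma> x \<noteq> x \<longleftrightarrow> x \<in> insert b A \<union> B"
      "\<And>x. x \<in> A \<Longrightarrow> \<sigma> x \<notin> A" "\<sigma> b \<notin> A"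
    by (auto simp: matchings_def)
  have "\<sigma> x \<noteq> b" if "x \<in> A" for x
    using *(1)[of x] *(4) that by auto
  with * show "\<sigma> \<in> matchings (insert b A) B" by (auto simp: matchings_def)
next
  fix \<sigma> assume "\<sigma> \<in> matchings (insert b A) B"
  then have "\<And>x. \<sigma> (\<sigma> x) = x" "\<And>x. \<sigma> x \<noteq> x \<longleftrightarrow> x \<in> A \<union> insert b B"
      "\<And>x. x \<in> insert b A \<Longrightarrow> \<sigma> x \<notin> insert b A"
    by (auto simp: matchings_def)
  then show "\<sigma> \<in> {\<sigma> \<in> matchings A (insert b B). \<sigma> b \<notin> A}"
    unfolding matchings_def by blast
qed

text \<open>Drawing the arc from \<open>i\<close> to \<open>b\<close> is undone by making both ends
  fixed points, so closing the arc of \<open>i\<close> leaves a matching problem without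
  \<open>i\<close> and \<open>b\<close>.\<close>

lemma matchings_closer:
  assumes "b \<notin> A" "b \<notin> B" "i \<in> A" "A \<inter> B = {}"
  shows "bij_betw (\<lambda>\<sigma>. \<sigma>(i := b, b := i)) (matchings (A - {i}) B)
           {\<sigma> \<in> matchings A (insert b B). \<sigma> b = i}"
proof (rule bij_betw_byWitness[where f' = "\<lambda>\<sigma>. \<sigma>(i := i, b := b)"])
  have ib: "i \<noteq> b" "i \<notin> B" using assms by auto
  show "\<forall>\<sigma>\<in>matchings (A - {i}) B. (\<sigma>(i := b, b := i))(i := i, b := b) = \<sigma>"
  proof
    fix \<sigma> assume "\<sigma> \<in> matchings (A - {i}) B"
    then have "\<sigma> i = i" "\<sigma> b = b" using assms ib unfolding matchings_def by blast+
    then show "(\<sigma>(i := b, b := i))(i := i, b := b) = \<sigma>" by auto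
  qed
  show "\<forall>\<sigma>\<in>{\<sigma> \<in> matchings A (insert b B). \<sigma> b = i}. (\<sigma>(i := i, b := b))(i := b, b := i) = \<sigma>"
  proof clarify
    fix \<sigma> assume "\<sigma> \<in> matchings A (insert b B)"
    then have "\<sigma> (\<sigma> b) = b" by (simp add: matchings_def)
    then show "(\<sigma>(\<sigma> b := \<sigma> b, b := b))(\<sigma> b := b, b := \<sigma> b) = \<sigma>" by auto
  qed
  show "(\<lambda>\<sigma>. \<sigma>(i := b, b := i)) ` matchings (A - {i}) B
          \<subseteq> {\<sigma> \<in> matchings A (insert b B). \<sigma> b = i}"
  proof clarify
    fix \<sigma> assume "\<sigma> \<in> matchings (A - {i}) B"
    then have *: "\<And>x. \<sigma> (\<sigma> x) = x" "\<And>x. \<sigma> x \<noteq> x \<longleftrightarrow> x \<in> (A - {i}) \<union> B"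
      "\<And>x. x \<in> A - {i} \<Longrightarrow> \<sigma> x \<notin> A - {i}"
      by (auto simp: matchings_def)
    let ?\<tau> = "\<sigma>(i := b, b := i)"
    have fixed: "\<sigma> i = i" "\<sigma> b = b" using *(2) assms ib by blast+
    then have other: "\<sigma> x \<noteq> i \<and> \<sigma> x \<noteq> b" if "x \<noteq> i" "x \<noteq> b" for x
      using *(1)[of x] that by metis
    have "?\<tau> (?\<tau> x) = x \<and> (?\<tau> x \<noteq> x \<longleftrightarrow> x \<in> A \<union> insert b B) \<and> (x \<in> A \<longrightarrow> ?\<tau> x \<notin> A)" for x
    proof -
      consider "x = i" | "x = b" | "x \<noteq> i" "x \<noteq> b" by blast
      then show ?thesis
      proof cases
        case 3
        then show ?thesis using *(1)[of x] *(2)[of x] *(3)[of x] other[of x] by auto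
      qed (use assms ib in auto)
    qed
    then show "?\<tau> \<in> matchings A (insert b B) \<and> ?\<tau> b = i"
      by (simp add: matchings_def)
  qed
  show "(\<lambda>\<sigma>. \<sigma>(i := i, b := b)) ` {\<sigma> \<in> matchings A (insert b B). \<sigma> b = i}
          \<subseteq> matchings (A - {i}) B"
  proof clarify
    fix \<sigma> assume "\<sigma> \<in> matchings A (insert b B)" and i: "i = \<sigma> b"
    then have *: "\<And>x. \<sigma> (\<sigma> x) = x" "\<And>x. \<sigma> x \<noteq> x \<longleftrightarrow> x \<in> insert b A \<union> B"
      "\<And>x. x \<in> A \<Longrightarrow> \<sigma> x \<notin> A"
      by (auto simp: matchings_def)
    let ?\<tau> = "\<sigma>(i := i, b := b)"
    \<comment> \<open>The involution exchanges \<open>i\<close> and \<open>b\<close>, so no third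
      point is sent to either of them.\<close>
    have other: "\<sigma> x \<noteq> i \<and> \<sigma> x \<noteq> b" if "x \<noteq> i" "x \<noteq> b" for x
      using *(1)[of x] *(1)[of b] i that by metis
    have "?\<tau> (?\<tau> x) = x \<and> (?\<tau> x \<noteq> x \<longleftrightarrow> x \<in> (A - {i}) \<union> B) \<and> (x \<in> A - {i} \<longrightarrow> ?\<tau> x \<notin> A - {i})"
      for x
    proof -
      consider "x = i" | "x = b" | "x \<noteq> i" "x \<noteq> b" by blast
      then show ?thesis
      proof cases
        case 3
        then show ?thesis using *(1)[of x] *(2)[of x] *(3)[of x] other[of x] by auto
      qed (use assms ib in auto)
    qed
    then show "\<sigma>(\<sigma> b := \<sigma> b, b := b) \<in> matchings (A - {\<sigma> b}) B"
      unfolding matchings_def i[symmetric] by blast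
  qed
qed

text \<open>Arcs still open at \<open>b\<close> end to the right of \<open>b\<close>. Those starting
  before \<open>i\<close> therefore enclose the new arc, and those starting between \<open>i\<close>
  and \<open>b\<close> cross it; arcs starting in \<open>B\<close> lie wholly to the right of
  it.\<close>

lemma crossing_number_closer:
  fixes A B :: "'b::linorder set"
  assumes fin: "finite A" "finite B" and less: "\<forall>x\<in>A. x < b" "\<forall>x\<in>B. b < x" and i: "i \<in> A"
    and \<sigma>: "\<sigma> \<in> matchings (A - {i}) B"
  shows "crossing_number (\<sigma>(i := b, b := i)) = crossing_number \<sigma> + card {k \<in> A. i < k}"
proof -
  let ?\<tau> = "\<sigma>(i := b, b := i)"
  let ?X = "\<lambda>\<tau>. {(x, y). x < y \<and> y < \<tau> x \<and> \<tau> x < \<tau> y}"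
  have *: "\<And>x. \<sigma> (\<sigma> x) = x" "\<And>x. \<sigma> x \<noteq> x \<longleftrightarrow> x \<in> (A - {i}) \<union> B"
      "\<And>x. x \<in> A - {i} \<Longrightarrow> \<sigma> x \<notin> A - {i}"
    using \<sigma> by (auto simp: matchings_def)
  have "i < b" using i less by auto
  have fixed: "\<sigma> i = i" "\<sigma> b = b" using *(2) less i by (auto dest: less_imp_not_less)
  have up: "b < \<sigma> x" if "x \<in> A - {i}" for x
  proof -
    have "\<sigma> x \<noteq> x" using that *(2) by blast
    then have "\<sigma> (\<sigma> x) \<noteq> \<sigma> x" using *(1) by metis
    then have "\<sigma> x \<in> (A - {i}) \<union> B" using *(2) by blast
    then show ?thesis using *(3)[OF that] less by blast
  qed
  have low: "x \<in> A - {i}" if "x < b" "\<sigma> x \<noteq> x" for x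
    using that *(2)[of x] less by (auto dest: less_imp_not_less)
  have fin\<sigma>: "finite (?X \<sigma>)"
  proof (rule finite_subset)
    have "y \<in> A \<union> B \<and> x \<in> A \<union> B" if "x < y" "y < \<sigma> x" "\<sigma> x < \<sigma> y" for x y
      using *(2)[of x] *(2)[of y] that by auto
    then show "?X \<sigma> \<subseteq> (A \<union> B) \<times> (A \<union> B)" by auto
  qed (use fin in auto)
  \<comment> \<open>Old crossings survive, and in every new one the arc from \<open>i\<close> to
    \<open>b\<close> comes first: an arc starting before \<open>i\<close> cannot end between
    \<open>i\<close> and \<open>b\<close>, by \<open>low\<close> and \<open>up\<close>.\<close>
  have "?X ?\<tau> = ?X \<sigma> \<union> Pair i ` {k \<in> A. i < k}"
  proof -
    have "(x, y) \<in> ?X ?\<tau> \<longleftrightarrow> (x, y) \<in> ?X \<sigma> \<union> Pair i ` {k \<in> A. i < k}" for x y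
    proof -
      consider "x = i" | "x = b" | "x \<noteq> i" "x \<noteq> b" "y = i" | "x \<noteq> i" "x \<noteq> b" "y = b"
        | "x \<noteq> i" "x \<noteq> b" "y \<noteq> i" "y \<noteq> b" by blast
      then show ?thesis
      proof cases
        case 1
        have "i < y \<and> y < b \<and> b < ?\<tau> y \<longleftrightarrow> y \<in> A \<and> i < y"
        proof
          assume y: "i < y \<and> y < b \<and> b < ?\<tau> y"
          then have "\<sigma> y \<noteq> y" by (auto split: if_splits)
          with y low show "y \<in> A \<and> i < y" by auto
        qed (use up less in auto)
        with 1 fixed \<open>i < b\<close> show ?thesis by auto
      next
        case 2
        with fixed \<open>i < b\<close> show ?thesis by auto
      next
        case 3
        have "\<not> (x < i \<and> i < \<sigma> x \<and> \<sigma> x < b)"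
          using low[of x] up[of x] \<open>i < b\<close> by (metis less_asym' less_trans less_irrefl)
        with 3 fixed \<open>i < b\<close> show ?thesis by auto
      next
        case 4
        with fixed \<open>i < b\<close> show ?thesis by auto
      next
        case 5
        then show ?thesis by auto
      qed
    qed
    then show ?thesis by (simp add: set_eq_iff split_paired_all del: Un_iff mem_Collect_eq)
  qed
  moreover have "?X \<sigma> \<inter> Pair i ` {k \<in> A. i < k} = {}" using fixed by auto
  ultimately show ?thesis
    unfolding crossing_number_def using fin\<sigma> fin by (simp add: card_Un_disjoint card_image inj_on_def)
qed

section \<open>The recurrence for the sum over matchings\<close>

lemma q_number_Suc: "q_number (Suc n) q = q_number n q + q ^ n"
  by (simp add: q_number_def)

text \<open>Counted from the largest element down, the exponents are 0, 1, 2 and so on. A new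
  minimum leaves the old exponents alone and adds the exponent \<open>card A\<close>.\<close>

lemma sum_power_card_greater:
  fixes A :: "'b::linorder set"
  assumes "finite A"
  shows "(\<Sum>i\<in>A. q ^ card {k \<in> A. i < k}) = q_number (card A) q"
  using assms
proof (induction rule: finite_linorder_min_induct)
  case empty
  then show ?case by (simp add: q_number_def)
next
  case (insert b A)
  have "{k. (k = b \<or> k \<in> A) \<and> i < k} = {k \<in> A. i < k}" if "i \<in> A" for i
    using insert that by (auto dest: less_imp_not_less)
  moreover have "{k. (k = b \<or> k \<in> A) \<and> b < k} = A" using insert by auto
  moreover have "b \<notin> A" using insert by auto
  ultimately show ?case using insert by (simp add: q_number_Suc)
qed

text \<open>Split by the partner of \<open>b\<close>: outside \<open>A\<close> the point opens an
  arc, and at \<open>i \<in> A\<close> it closes the arc of \<open>i\<close>, at the cost of one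
  crossing for each open left end beyond \<open>i\<close>.\<close>

lemma sum_matchings_insert:
  fixes A B :: "'b::linorder set" and q :: "'a::comm_semiring_1"
  assumes fin: "finite A" "finite B" and less: "\<forall>x\<in>A. x < b" "\<forall>x\<in>B. b < x"
  shows "(\<Sum>\<sigma>\<in>matchings A (insert b B). q ^ crossing_number \<sigma>) =
    (\<Sum>\<sigma>\<in>matchings (insert b A) B. q ^ crossing_number \<sigma>) +
    (\<Sum>i\<in>A. q ^ card {k \<in> A. i < k} * (\<Sum>\<sigma>\<in>matchings (A - {i}) B. q ^ crossing_number \<sigma>))"
proof -
  let ?M = "matchings A (insert b B)"
  have b: "b \<notin> A" "b \<notin> B" "A \<inter> B = {}" using less by (auto dest: less_imp_not_less)
  have finM: "finite ?M" using fin by (intro finite_matchings) auto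
  have "(\<Sum>\<sigma>\<in>?M. q ^ crossing_number \<sigma>) =
      (\<Sum>\<sigma>\<in>{\<sigma>\<in>?M. \<sigma> b \<notin> A}. q ^ crossing_number \<sigma>) + (\<Sum>\<sigma>\<in>{\<sigma>\<in>?M. \<sigma> b \<in> A}. q ^ crossing_number \<sigma>)"
    using finM by (subst sum.union_disjoint[symmetric]) (auto intro: sum.cong)
  also have "(\<Sum>\<sigma>\<in>{\<sigma>\<in>?M. \<sigma> b \<in> A}. q ^ crossing_number \<sigma>) =
      (\<Sum>i\<in>A. \<Sum>\<sigma>\<in>{\<sigma>\<in>{\<sigma>\<in>?M. \<sigma> b \<in> A}. \<sigma> b = i}. q ^ crossing_number \<sigma>)"
    using finM fin by (intro sum.group[symmetric]) auto
  also have "\<dots> = (\<Sum>i\<in>A. q ^ card {k \<in> A. i < k} * (\<Sum>\<sigma>\<in>matchings (A - {i}) B. q ^ crossing_number \<sigma>))"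
  proof (rule sum.cong[OF refl])
    fix i assume i: "i \<in> A"
    then have "{\<sigma>\<in>{\<sigma>\<in>?M. \<sigma> b \<in> A}. \<sigma> b = i} = {\<sigma>\<in>?M. \<sigma> b = i}" by auto
    then have "(\<Sum>\<sigma>\<in>{\<sigma>\<in>{\<sigma>\<in>?M. \<sigma> b \<in> A}. \<sigma> b = i}. q ^ crossing_number \<sigma>) =
        (\<Sum>\<sigma>\<in>matchings (A - {i}) B. q ^ crossing_number (\<sigma>(i := b, b := i)))"
      using sum.reindex_bij_betw[OF matchings_closer[OF b(1,2) i b(3)], of "\<lambda>\<sigma>. q ^ crossing_number \<sigma>"]
      by (simp only:)
    also have "\<dots> = (\<Sum>\<sigma>\<in>matchings (A - {i}) B. q ^ card {k \<in> A. i < k} * q ^ crossing_number \<sigma>)"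
      using crossing_number_closer[OF fin less i] by (intro sum.cong) (auto simp: power_add mult.commute)
    finally show "(\<Sum>\<sigma>\<in>{\<sigma>\<in>{\<sigma>\<in>?M. \<sigma> b \<in> A}. \<sigma> b = i}. q ^ crossing_number \<sigma>) =
        q ^ card {k \<in> A. i < k} * (\<Sum>\<sigma>\<in>matchings (A - {i}) B. q ^ crossing_number \<sigma>)"
      by (simp only: sum_distrib_left)
  qed
  finally show ?thesis using matchings_opener[OF b(1,2)] by simp
qed

section \<open>The same recurrence for the weights of sets of left ends\<close>

text \<open>A left end has no factor of its own, and preceding all of \<open>B\<close> it raises the
  height at every later right end by one.\<close>

lemma closer_weight_opener:
  fixes B :: "'b::linorder set"
  assumes "finite B" "\<forall>x\<in>B. b < x" "C \<subseteq> B"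
  shows "closer_weight a (insert b B) (insert b C) q = closer_weight (Suc a) B C q"
proof -
  have b: "b \<notin> B" using assms by auto
  have eq: "insert b B - insert b C = B - C" using b assms by auto
  have "height a (insert b B) (insert b C) d = height (Suc a) B C d" if "d \<in> B - C" for d
  proof -
    have "{x \<in> insert b C. x < d} = insert b {x \<in> C. x < d}" using that assms by auto
    moreover have "finite C" "b \<notin> C" using assms b finite_subset by auto
    ultimately show ?thesis unfolding height_def eq by simp
  qed
  then show ?thesis unfolding closer_weight_def eq by (intro prod.cong) auto
qed

text \<open>Nothing precedes \<open>b\<close>, so its factor has height \<open>a\<close>; every
  later right end then sees one open arc fewer.\<close>

lemma closer_weight_closer:
  fixes B :: "'b::linorder set"
  assumes "finite B" "\<forall>x\<in>B. b < x" "C \<subseteq> B"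
  shows "closer_weight a (insert b B) C q = q_number a q * closer_weight (a - 1) B C q"
proof -
  have b: "b \<notin> B" "b \<notin> C" using assms by auto
  have eq: "insert b B - C = insert b (B - C)" using b by auto
  have "{x \<in> insert b (B - C). x < b} = {}" "{x \<in> C. x < b} = {}"
    using assms by (auto dest: less_imp_not_less)
  then have "height a (insert b B) C b = a"
    unfolding height_def eq by (simp only: card.empty add_0_right diff_zero)
  then have *: "closer_weight a (insert b B) C q =
      q_number a q * (\<Prod>d\<in>B - C. q_number (height a (insert b B) C d) q)"
    using assms b unfolding closer_weight_def eq by simp
  show ?thesis
  \<comment> \<open>For \<open>a = 0\<close> the truncated \<open>a - 1\<close> is not the height
    after \<open>b\<close>, but the factor \<open>q_number 0 q = 0\<close> kills both sides. For
    positive \<open>a\<close> the unit lost to \<open>b\<close> can be taken from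
    \<open>a\<close>.\<close>
  proof (cases "a = 0")
    case True
    with * show ?thesis by (simp add: q_number_def)
  next
    case False
    have "height a (insert b B) C d = height (a - 1) B C d" if "d \<in> B - C" for d
    proof -
      have "{x \<in> insert b (B - C). x < d} = insert b {x \<in> B - C. x < d}"
        using that assms by auto
      then have "card {x \<in> insert b (B - C). x < d} = Suc (card {x \<in> B - C. x < d})"
        using b assms by (simp only:) (intro card_insert_disjoint, auto)
      then show ?thesis using False unfolding height_def eq by linarith
    qed
    then show ?thesis unfolding * by (simp add: closer_weight_def)
  qed
qed

lemma sum_subsets_insert:
  assumes "finite B" "b \<notin> B"
  shows "(\<Sum>C | C \<subseteq> insert b B \<and> P C. f C) =
    (\<Sum>C | C \<subseteq> B \<and> P (insert b C). f (insert b C)) + (\<Sum>C | C \<subseteq> B \<and> P C. f C)"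
proof -
  have "{C. C \<subseteq> insert b B \<and> P C} = insert b ` {C. C \<subseteq> B \<and> P (insert b C)} \<union> {C. C \<subseteq> B \<and> P C}"
  proof (intro set_eqI iffI)
    fix C assume C: "C \<in> {C. C \<subseteq> insert b B \<and> P C}"
    show "C \<in> insert b ` {C. C \<subseteq> B \<and> P (insert b C)} \<union> {C. C \<subseteq> B \<and> P C}"
    proof (cases "b \<in> C")
      case True
      then have "C = insert b (C - {b})" by auto
      with C show ?thesis by (auto simp: image_iff intro!: exI[of _ "C - {b}"])
    qed (use C in auto)
  qed auto
  moreover have "inj_on (insert b) {C. C \<subseteq> B \<and> P (insert b C)}"
    using assms by (auto simp: inj_on_def)
  moreover have "insert b ` {C. C \<subseteq> B \<and> P (insert b C)} \<inter> {C. C \<subseteq> B \<and> P C} = {}"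
    using assms by auto
  ultimately show ?thesis
    using assms by (simp add: sum.union_disjoint sum.reindex)
qed

text \<open>Both sides satisfy the same recurrence in the least point \<open>b\<close> of
  \<open>B\<close>; \<open>A\<close> has to vary in the induction, as it gains \<open>b\<close> or
  loses some \<open>i\<close>. The condition on \<open>C\<close> balances the
  \<open>card A + card C\<close> left ends against the \<open>card B - card C\<close> right
  ends.\<close>

lemma sum_matchings_eq_sum_openers:
  fixes A B :: "'b::linorder set"
  assumes "finite B" "finite A" "\<forall>x\<in>A. \<forall>y\<in>B. x < y"
  shows "(\<Sum>\<sigma>\<in>matchings A B. q ^ crossing_number \<sigma>) =
    (\<Sum>C | C \<subseteq> B \<and> card A + 2 * card C = card B. closer_weight (card A) B C q)"
  using assms
proof (induction arbitrary: A rule: finite_linorder_min_induct)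
  case empty
  show ?case
  proof (cases "A = {}")
    case True
    have "crossing_number (id :: 'b \<Rightarrow> 'b) = 0"
      unfolding crossing_number_def by (rule card_eq_0_iff[THEN iffD2]) auto
    then have "(\<Sum>\<sigma>\<in>matchings A {}. q ^ crossing_number \<sigma>) = 1"
      using True by (simp add: matchings_empty_right del: id_apply)
    moreover have "{C. C \<subseteq> {} \<and> card A + 2 * card C = card ({} :: 'b set)} = {{} :: 'b set}"
      using True by auto
    ultimately show ?thesis by (simp only:) (simp add: closer_weight_def)
  qed (use empty in \<open>simp add: matchings_empty_right\<close>)
next
  case (insert b B)
  have b: "b \<notin> B" "b \<notin> A" using insert by auto
  have less: "\<forall>x\<in>A. x < b" using insert by auto
  \<comment> \<open>The right-hand side depends on \<open>A\<close> only through its size, so after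
    a closer it is the same for every choice of \<open>i\<close> and factors out of the sum over
    \<open>i\<close>.\<close>
  let ?S = "\<lambda>a. \<Sum>C | C \<subseteq> B \<and> a + 2 * card C = card B. closer_weight a B C q"
  have "(\<Sum>\<sigma>\<in>matchings (insert b A) B. q ^ crossing_number \<sigma>) = ?S (Suc (card A))"
    using insert.IH[of "insert b A"] insert b by auto
  also have "\<dots> = (\<Sum>C | C \<subseteq> B \<and> card A + 2 * card (insert b C) = card (insert b B).
       closer_weight (card A) (insert b B) (insert b C) q)"
  proof (intro sum.cong set_eqI)
    fix C
    have "card (insert b C) = Suc (card C)" if "C \<subseteq> B"
      using that b insert by (meson card_insert_disjoint finite_subset subsetD)
    then show "C \<in> {C. C \<subseteq> B \<and> Suc (card A) + 2 * card C = card B} \<longleftrightarrow>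
      C \<in> {C. C \<subseteq> B \<and> card A + 2 * card (insert b C) = card (insert b B)}"
      using insert b by auto
  next
    fix C assume "C \<in> {C. C \<subseteq> B \<and> card A + 2 * card (insert b C) = card (insert b B)}"
    then show "closer_weight (Suc (card A)) B C q = closer_weight (card A) (insert b B) (insert b C) q"
      using closer_weight_opener insert by (metis (no_types, lifting) mem_Collect_eq)
  qed
  finally have opener: "(\<Sum>\<sigma>\<in>matchings (insert b A) B. q ^ crossing_number \<sigma>) = \<dots>" .
  have "(\<Sum>i\<in>A. q ^ card {k \<in> A. i < k} * (\<Sum>\<sigma>\<in>matchings (A - {i}) B. q ^ crossing_number \<sigma>)) =
      (\<Sum>i\<in>A. q ^ card {k \<in> A. i < k} * ?S (card A - 1))"
    using insert by (intro sum.cong refl) (subst insert.IH, auto)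
  also have "\<dots> = q_number (card A) q * ?S (card A - 1)"
    using sum_power_card_greater[of A q] insert by (simp flip: sum_distrib_right)
  also have "\<dots> = (\<Sum>C | C \<subseteq> B \<and> card A + 2 * card C = card (insert b B).
       closer_weight (card A) (insert b B) C q)"
  \<comment> \<open>With no open arc the truncated \<open>card A - 1\<close> gives the two sums
    different ranges, but \<open>q_number 0 q = 0\<close> makes both sides vanish.\<close>
  proof (cases "card A = 0")
    case True
    then show ?thesis using closer_weight_closer[of B b _ 0 q] insert
      by (simp add: q_number_def)
  next
    case False
    moreover have "card (insert b B) = Suc (card B)" using insert b by simp
    ultimately have "{C. C \<subseteq> B \<and> card A - 1 + 2 * card C = card B} =
        {C. C \<subseteq> B \<and> card A + 2 * card C = card (insert b B)}"
      by (intro Collect_cong) linarith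
    then show ?thesis using closer_weight_closer[of B b _ "card A" q] insert
      by (simp add: sum_distrib_left)
  qed
  finally show ?case
    using opener sum_matchings_insert[of A B b q] less insert b
    by (subst sum_subsets_insert) auto
qed

section \<open>Translation to involutions and increasing sequences\<close>

lemma fpf_involutions_eq_matchings: "fpf_involutions m = matchings {} {1..2 * m}"
proof (intro set_eqI iffI)
  fix \<sigma> assume "\<sigma> \<in> matchings {} {1..2 * m}"
  with matchings_subset[of "{}" "{1..2 * m}"] show "\<sigma> \<in> fpf_involutions m"
    by (auto simp: fpf_involutions_def matchings_def)
next
  fix \<sigma> assume *: "\<sigma> \<in> fpf_involutions m"
  then have "\<sigma> (\<sigma> x) = x \<and> (\<sigma> x \<noteq> x \<longleftrightarrow> x \<in> {1..2 * m})" for x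
    by (cases "x \<in> {1..2 * m}") (auto simp: fpf_involutions_def permutes_def)
  then show "\<sigma> \<in> matchings {} {1..2 * m}"
    by (simp add: matchings_def)
qed

text \<open>An arc is determined by its left end, and the bound on left ends in \<open>arcs\<close>
  is automatic because \<open>\<sigma>\<close> fixes all other points.\<close>

lemma v_eq_crossing_number:
  assumes "\<sigma> \<in> fpf_involutions m"
  shows "v m \<sigma> = crossing_number \<sigma>"
proof -
  have "x \<in> {1..2 * m}" if "\<sigma> x \<noteq> x" for x
    using that assms by (auto simp: fpf_involutions_def permutes_def)
  then have arcs: "arcs m \<sigma> = {(x, \<sigma> x) | x. x < \<sigma> x}"
    unfolding arcs_def by (metis (mono_tags, lifting) nat_less_le)
  have "crossings m \<sigma> = (\<lambda>(x, y). ((x, \<sigma> x), (y, \<sigma> y))) `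
      {(x, y). x < y \<and> y < \<sigma> x \<and> \<sigma> x < \<sigma> y}"
    unfolding crossings_def arcs by force
  then show ?thesis
    unfolding v_def crossing_number_def by (simp add: card_image inj_on_def split_beta prod_eq_iff)
qed

text \<open>By monotonicity the elements up to \<open>c i\<close> are the values at
  \<open>1..i\<close>. Thus the index of a value can be read off from the image set alone.\<close>

lemma rank_increasing_seq:
  assumes "c \<in> increasing_seqs m" "i \<in> {1..m}"
  shows "card {x \<in> c ` {1..m}. x \<le> c i} = i"
proof -
  have sm: "strict_mono_on {1..m} c" using assms by (simp add: increasing_seqs_def)
  have "{x \<in> c ` {1..m}. x \<le> c i} = c ` {1..i}"
  proof -
    have "c k \<le> c i \<longleftrightarrow> k \<le> i" if "k \<in> {1..m}" for k
      using strict_mono_onD[OF sm that assms(2)] strict_mono_onD[OF sm assms(2) that]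
      by (cases k i rule: linorder_cases) auto
    then show ?thesis using assms(2) by auto
  qed
  moreover have "inj_on c {1..i}"
    by (rule inj_on_subset[OF strict_mono_on_imp_inj_on[OF sm]]) (use assms in auto)
  ultimately show ?thesis by (simp add: card_image)
qed

lemma bij_betw_increasing_seqs:
  "bij_betw (\<lambda>c. c ` {1..m}) (increasing_seqs m) {C. C \<subseteq> {1..2 * m} \<and> card C = m}"
proof (intro bij_betwI')
  fix c d assume c: "c \<in> increasing_seqs m" and d: "d \<in> increasing_seqs m"
  show "(c ` {1..m} = d ` {1..m}) = (c = d)"
  proof
    assume eq: "c ` {1..m} = d ` {1..m}"
    have "c i = d i" if i: "i \<in> {1..m}" for i
    proof -
      have "c i \<in> d ` {1..m}" unfolding eq[symmetric] using i by (rule imageI)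
      then obtain j where j: "j \<in> {1..m}" "c i = d j" by blast
      \<comment> \<open>Both indices are the rank of the same value in the same set.\<close>
      then have "i = j"
        using rank_increasing_seq[OF c i] rank_increasing_seq[OF d j(1)] eq by simp
      with j show ?thesis by simp
    qed
    moreover have "c i = d i" if "i \<notin> {1..m}" for i
      using c d that by (auto simp: increasing_seqs_def PiE_def extensional_def)
    ultimately show "c = d" by auto
  qed simp
next
  fix c assume "c \<in> increasing_seqs m"
  then show "c ` {1..m} \<in> {C. C \<subseteq> {1..2 * m} \<and> card C = m}"
    using strict_mono_on_imp_inj_on[of "{1..m}" c]
    by (auto simp: increasing_seqs_def card_image)
next
  fix C assume "C \<in> {C. C \<subseteq> {1..2 * m} \<and> card C = m}"
  then have C: "C \<subseteq> {1..2 * m}" "card C = m" "finite C" using finite_subset by auto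
  define xs where "xs = sorted_list_of_set C"
  have xs: "sorted_wrt (<) xs" "set xs = C" "length xs = m"
    using C strict_sorted_list_of_set[of C] by (auto simp: xs_def)
  \<comment> \<open>The sorted enumeration of \<open>C\<close>, shifted because list positions start
    at 0.\<close>
  define c where "c = (\<lambda>i\<in>{1..m}. xs ! (i - 1))"
  have im: "c ` {1..m} = C"
  proof -
    have "c ` {1..m} = (\<lambda>i. xs ! i) ` (\<lambda>i. i - 1) ` {1..m}"
      by (auto simp: c_def image_image)
    also have "(\<lambda>i. i - 1) ` {1..m} = {..<m}"
      by (auto simp: image_iff intro!: bexI[of _ "Suc _"])
    finally show ?thesis using xs by (auto simp: set_conv_nth)
  qed
  moreover have "strict_mono_on {1..m} c"
    using xs by (auto simp: strict_mono_on_def c_def sorted_wrt_iff_nth_less)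
  ultimately have "c \<in> increasing_seqs m"
    using C by (auto simp: increasing_seqs_def c_def)
  then show "\<exists>c\<in>increasing_seqs m. C = c ` {1..m}" using im by auto
qed

text \<open>The right ends are numbered increasingly by \<open>?j\<close>, which reindexes the
  product. Before the right end numbered \<open>j\<close> there are \<open>j - 1\<close> right ends
  and \<open>r m c j\<close> left ends, so the factors agree.\<close>

lemma closer_weight_increasing_seq:
  assumes c: "c \<in> increasing_seqs m"
  shows "closer_weight 0 {1..2 * m} (c ` {1..m}) q =
    (\<Prod>j=1..m. q_number (r m c j - (j - 1)) q)"
proof -
  let ?C = "c ` {1..m}"
  let ?D = "{1..2 * m} - ?C"
  let ?j = "\<lambda>d. card {x \<in> ?D. x \<le> d}"
  have C: "?C \<subseteq> {1..2 * m}" "card ?C = m"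
    using bij_betwE[OF bij_betw_increasing_seqs] c by blast+
  have inj: "inj_on c {1..m}"
    using c strict_mono_on_imp_inj_on by (auto simp: increasing_seqs_def)
  have mono: "?j d < ?j e" if "d < e" "e \<in> ?D" for d e
  proof (intro psubset_card_mono psubsetI)
    have "e \<in> {x \<in> ?D. x \<le> e}" "e \<notin> {x \<in> ?D. x \<le> d}" using that by auto
    then show "{x \<in> ?D. x \<le> d} \<noteq> {x \<in> ?D. x \<le> e}" by blast
  qed (use that in auto)
  have injj: "inj_on ?j ?D"
  proof (rule inj_onI, rule ccontr)
    fix d e assume de: "d \<in> ?D" "e \<in> ?D" "?j d = ?j e" "d \<noteq> e"
    from \<open>d \<noteq> e\<close> have "d < e \<or> e < d" by linarith
    then have "?j d < ?j e \<or> ?j e < ?j d" using mono[of d e] mono[of e d] de(1,2) by blast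
    with de(3) show False by linarith
  qed
  have D: "card ?D = m" using C by (simp add: card_Diff_subset finite_subset)
  \<comment> \<open>An injective map from \<open>m\<close> right ends into \<open>{1..m}\<close> is
    onto.\<close>
  have "?j ` ?D = {1..m}"
  proof (rule card_subset_eq)
    have "1 \<le> ?j d \<and> ?j d \<le> m" if "d \<in> ?D" for d
    proof -
      have "?j d \<le> card ?D" by (intro card_mono) auto
      moreover have "{x \<in> ?D. x \<le> d} \<noteq> {}" using that by blast
      then have "?j d \<noteq> 0" by (simp del: Diff_iff)
      ultimately show ?thesis using D by linarith
    qed
    then show "?j ` ?D \<subseteq> {1..m}" by auto
    show "card (?j ` ?D) = card {1..m}" using injj D by (simp add: card_image)
  qed simp
  then have bij: "bij_betw ?j ?D {1..m}" using injj by (simp add: bij_betw_def)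
  have "height 0 {1..2 * m} ?C d = r m c (?j d) - (?j d - 1)" if d: "d \<in> ?D" for d
  proof -
    have "{x \<in> ?D. x \<le> d} = insert d {x \<in> ?D. x < d}" using d by auto
    then have jd: "?j d = Suc (card {x \<in> ?D. x < d})" by simp
    \<comment> \<open>Up to \<open>c i\<close> there are \<open>i\<close> left ends and
      \<open>?j (c i)\<close> right ends, so \<open>c i = i + ?j (c i)\<close>. The inequality thus
      says that fewer than \<open>?j d\<close> right ends lie up to \<open>c i\<close>, that is,
      \<open>c i\<close> comes before \<open>d\<close>.\<close>
    have "c i \<le> ?j d + i - 1 \<longleftrightarrow> c i < d" if i: "i \<in> {1..m}" for i
    proof -
      have ci: "c i \<in> ?C" "c i \<in> {1..2 * m}" using i C(1) by blast+
      have "{1..c i} = {x \<in> ?C. x \<le> c i} \<union> {x \<in> ?D. x \<le> c i}" using C ci by auto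
      then have "card {1..c i} = card {x \<in> ?C. x \<le> c i} + card {x \<in> ?D. x \<le> c i}"
        by (simp add: card_Un_disjoint disjoint_iff)
      then have ri: "c i = i + ?j (c i)" using rank_increasing_seq[OF c i] by simp
      have "c i \<noteq> d" using ci d by auto
      then consider "c i < d" | "d < c i" by linarith
      then show ?thesis
      proof cases
        case 1
        then show ?thesis using mono[OF 1 d] ri by linarith
      next
        case 2
        then have "?j d \<le> ?j (c i)" by (intro card_mono) auto
        with ri 2 jd show ?thesis by linarith
      qed
    qed
    then have "r m c (?j d) = card {i \<in> {1..m}. c i < d}"
      unfolding r_def by (intro arg_cong[of _ _ card]) auto
    also have "\<dots> = card (c ` {i \<in> {1..m}. c i < d})"
      by (intro card_image[symmetric] inj_on_subset[OF inj]) auto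
    also have "c ` {i \<in> {1..m}. c i < d} = {x \<in> ?C. x < d}" by auto
    finally show ?thesis unfolding height_def jd by simp
  qed
  then have "closer_weight 0 {1..2 * m} ?C q =
      (\<Prod>d\<in>?D. q_number (r m c (?j d) - (?j d - 1)) q)"
    unfolding closer_weight_def by (intro prod.cong) auto
  also have "\<dots> = (\<Prod>j=1..m. q_number (r m c j - (j - 1)) q)"
    by (rule prod.reindex_bij_betw[OF bij])
  finally show ?thesis .
qed

theorem theorem5p3:
  fixes m :: nat and q :: "'a::comm_ring_1"
  shows "T m q = (\<Sum>c\<in>increasing_seqs m. \<Prod>j=1..m. q_number (r m c j - (j - 1)) q)"
proof -
  have "T m q = (\<Sum>\<sigma>\<in>matchings {} {1..2 * m}. q ^ crossing_number \<sigma>)"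
    unfolding T_def fpf_involutions_eq_matchings[symmetric]
    by (intro sum.cong) (simp_all add: v_eq_crossing_number)
  \<comment> \<open>No arc is open before the point 1, so \<open>A = {}\<close> and the balance
    condition \<open>2 * card C = 2 * m\<close> becomes \<open>card C = m\<close>.\<close>
  also have "\<dots> = (\<Sum>C | C \<subseteq> {1..2 * m} \<and> card C = m. closer_weight 0 {1..2 * m} C q)"
    by (subst sum_matchings_eq_sum_openers) auto
  also have "\<dots> = (\<Sum>c\<in>increasing_seqs m. closer_weight 0 {1..2 * m} (c ` {1..m}) q)"
    by (rule sum.reindex_bij_betw[OF bij_betw_increasing_seqs, symmetric])
  also have "\<dots> = (\<Sum>c\<in>increasing_seqs m. \<Prod>j=1..m. q_number (r m c j - (j - 1)) q)"
    by (intro sum.cong refl closer_weight_increasing_seq)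
  finally show ?thesis .
qed

end
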